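(* Let $G$ be a graph on $n$ vertices and write $\beta(G,x)=\sum_{r=0}^n(-1)^r a_r x^{n-r}$. Then for each $r$, $$a_r=p(S_G,r)=\sum_{H\in\mathcal{H}_r(G)}\mathbf{w}(H),$$ where $\mathcal{H}_r(G)$ denotes the set of all TU-subgraphs of $G$ with $r$ edges.
   Context: All graphs are finite, undirected, without loops or multiple edges. $\mathcal{M}(G)$ is the set of matchings of $G$ including the empty set; $V(M)$ is the set of endpoints of edges of $M$; $d_G(v)$ is the degree of $v$. The Laplacian matching polynomial is $\beta(G,x)=\sum_{M\in\mathcal{M}(G)}(-1)^{|M|}\prod_{v\in V(G)\setminus V(M)}(x-d_G(v))$. The subdivision graph $S_G$ is obtained by inserting into each edge $\{u,v\}$ of $G$ a new vertex of degree $2$ adjacent to $u$ and $v$. $p(G,r)$ is the number of $r$-matchings of $G$, with $p(G,0)=1$. A TU-subgraph is a subgraph whose components are trees or unicyclic graphs (connected graphs with exactly one cycle); TU-subgraphs with $r$ edges are identified with their edge sets. If $H$ has $c$ unicyclic components and tree components $T_1,\dots,T_t$, then $\mathbf{w}(H)=2^c\prod_{i=1}^t|V(T_i)|$. *)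

theory Defs
  imports "HOL-Computational_Algebra.Polynomial"
begin

type_synonym 'a graph = "'a set \<times> 'a set set"

abbreviation verts :: "'a graph \<Rightarrow> 'a set" where "verts \<equiv> fst"
abbreviation edges :: "'a graph \<Rightarrow> 'a set set" where "edges \<equiv> snd"

definition simple_graph :: "'a graph \<Rightarrow> bool" where
  "simple_graph G \<longleftrightarrow> finite (verts G) \<and> (\<forall>e\<in>edges G. e \<subseteq> verts G \<and> card e = 2)"

definition vdegree :: "'a graph \<Rightarrow> 'a \<Rightarrow> nat" where
  "vdegree G v = card {e \<in> edges G. v \<in> e}"

definition matchings :: "'a graph \<Rightarrow> 'a set set set" where
  "matchings G = {M. M \<subseteq> edges G \<and> pairwise disjnt M}"

definition num_matchings :: "'a graph \<Rightarrow> nat \<Rightarrow> nat" where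
  "num_matchings G r = card {M \<in> matchings G. card M = r}"

definition laplacian_matching_poly :: "'a graph \<Rightarrow> int poly" where
  "laplacian_matching_poly G =
    (\<Sum>M\<in>matchings G. (- 1) ^ card M * (\<Prod>v\<in>verts G - \<Union>M. [:- int (vdegree G v), 1:]))"

(* The number a_r for r <= n; it is only meaningful in this range. *)
definition lmp_coeff :: "'a graph \<Rightarrow> nat \<Rightarrow> int" where
  "lmp_coeff G r = (- 1) ^ r * coeff (laplacian_matching_poly G) (card (verts G) - r)"

(* Inl v is an original vertex, Inr e is the vertex inserted into the edge e. *)
definition subdivision :: "'a graph \<Rightarrow> ('a + 'a set) graph" where
  "subdivision G =
    (Inl ` verts G \<union> Inr ` edges G, {{Inl v, Inr e} | v e. e \<in> edges G \<and> v \<in> e})"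

definition adj :: "'a graph \<Rightarrow> ('a \<times> 'a) set" where
  "adj G = {(u, v). {u, v} \<in> edges G}"

definition connected_graph :: "'a graph \<Rightarrow> bool" where
  "connected_graph G \<longleftrightarrow>
    verts G \<noteq> {} \<and> (\<forall>u\<in>verts G. \<forall>v\<in>verts G. (u, v) \<in> (adj G)\<^sup>*)"

definition induced_subgraph :: "'a graph \<Rightarrow> 'a set \<Rightarrow> 'a graph" where
  "induced_subgraph G C = (C, {e \<in> edges G. e \<subseteq> C})"

definition components :: "'a graph \<Rightarrow> 'a graph set" where
  "components G =
    (\<lambda>v. induced_subgraph G {u \<in> verts G. (v, u) \<in> (adj G)\<^sup>*}) ` verts G"

definition cycle_edges :: "'a list \<Rightarrow> 'a set set" where
  "cycle_edges xs = {{xs ! i, xs ! (Suc i mod length xs)} | i. i < length xs}"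

(* A cycle is recorded by its edge set, so that the rotations and the reversal of a
   vertex sequence count as the same cycle. *)
definition cycles :: "'a graph \<Rightarrow> 'a set set set" where
  "cycles G = {cycle_edges xs | xs.
    3 \<le> length xs \<and> distinct xs \<and> set xs \<subseteq> verts G \<and> cycle_edges xs \<subseteq> edges G}"

definition is_tree :: "'a graph \<Rightarrow> bool" where
  "is_tree G \<longleftrightarrow> connected_graph G \<and> cycles G = {}"

definition is_unicyclic :: "'a graph \<Rightarrow> bool" where
  "is_unicyclic G \<longleftrightarrow> connected_graph G \<and> (\<exists>!C. C \<in> cycles G)"

definition is_TU :: "'a graph \<Rightarrow> bool" where
  "is_TU H \<longleftrightarrow> (\<forall>K\<in>components H. is_tree K \<or> is_unicyclic K)"

(* TU-subgraphs with r edges are identified with their edge sets; the spanning subgraph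
   (verts G, F) represents the edge set F.  The choice of the vertex set does not matter:
   an isolated vertex is a tree component on one vertex and contributes a factor 1 to
   the weight. *)
definition TU_subgraphs :: "'a graph \<Rightarrow> nat \<Rightarrow> 'a graph set" where
  "TU_subgraphs G r =
    {(verts G, F) | F. F \<subseteq> edges G \<and> card F = r \<and> is_TU (verts G, F)}"

definition TU_weight :: "'a graph \<Rightarrow> nat" where
  "TU_weight H =
    2 ^ card {K \<in> components H. is_unicyclic K}
      * (\<Prod>K\<in>{K \<in> components H. is_tree K}. card (verts K))"

end

theory Submission
  imports Defs "HOL-Library.Transitive_Closure_Table"
begin

text \<open>
  Expanding the products over the vertices writes \<open>\<beta>(G, x)\<close> as a signed sum over pairs of a matching
  \<open>M\<close> and a partial assignment of incident edges to vertices outside \<open>M\<close>. Merging the two (both ends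
  of an edge of \<open>M\<close> are assigned that edge) gives an assignment \<open>Q\<close>, and the sum over the
  \<open>M\<close> merging to a given \<open>Q\<close> is the alternating sum over all subsets of the set of edges assigned to
  both of their ends. Hence only the injective assignments survive, and these are the matchings of
  the subdivision graph.

  An injective assignment with image \<open>F\<close> chooses distinct ends for the edges in \<open>F\<close>, independently on
  each component of the graph with edge set \<open>F\<close>. A connected graph with a prescribed unchosen vertex
  \<open>r\<close> has at most one such choice, namely away from \<open>r\<close>. So a tree has one choice per vertex, a unicyclic
  graph has two, and a connected graph with more edges than vertices has none.
\<close>

section \<open>Simple graphs and two algebraic expansion identities\<close>

lemma edgeE:
  assumes "simple_graph G" "e \<in> edges G" "v \<in> e"
  obtains w where "e = {v, w}" "v \<noteq> w" "w \<in> verts G" "v \<in> verts G"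
proof -
  have e: "e \<subseteq> verts G" "card e = 2" using assms by (auto simp: simple_graph_def)
  then obtain x y where xy: "e = {x, y}" "x \<noteq> y" by (auto simp: card_2_iff)
  show ?thesis
  proof (cases "v = x")
    case True
    then show ?thesis using that[of y] xy e by auto
  next
    case False
    then show ?thesis using that[of x] xy e assms(3) by auto
  qed
qed

lemma finite_edges: "simple_graph G \<Longrightarrow> finite (edges G)"
  by (rule finite_subset[of _ "Pow (verts G)"]) (auto simp: simple_graph_def)

text \<open>When the product is multiplied out, each factor contributes either \<open>x\<close> or
  minus one element of \<open>I v\<close>. The set \<open>P\<close> records the factors of the
  second kind with the element taken, and \<open>inj_on fst P\<close> says that it is the graph of a
  partial function.\<close>

lemma prod_minus_card_expand:
  fixes x :: "'c::comm_ring_1" and I :: "'v \<Rightarrow> 'w set"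
  assumes "finite W" "\<And>v. v \<in> W \<Longrightarrow> finite (I v)"
  shows "(\<Prod>v\<in>W. x - of_nat (card (I v))) =
    (\<Sum>P | P \<subseteq> Sigma W I \<and> inj_on fst P. (- 1) ^ card P * x ^ (card W - card P))"
  using assms
proof (induction W rule: finite_induct)
  case empty
  have "{P. P \<subseteq> Sigma {} I \<and> inj_on fst P} = {{}}" by auto
  then show ?case by simp
next
  case (insert w W)
  let ?A = "{P. P \<subseteq> Sigma W I \<and> inj_on fst P}"
  let ?t = "\<lambda>W P. (- 1) ^ card P * x ^ (card W - card P)"
  let ?i = "\<lambda>(e, P). insert (w, e) P"
  have finS: "finite (Sigma W I)" using insert by auto
  then have finA: "finite ?A" by simp
  have cP: "finite P \<and> card P \<le> card W" if "P \<in> ?A" for P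
  proof -
    have P: "P \<subseteq> Sigma W I" "inj_on fst P" using that by auto
    then have "fst ` P \<subseteq> W" by auto
    then show ?thesis
      using finite_subset[OF P(1) finS] card_inj_on_le[OF P(2) _ insert(1)] by blast
  qed
  \<comment> \<open>Case split on whether the new factor \<open>w\<close> contributes an element; if
    it does, what remains is a partial function on \<open>W\<close>.\<close>
  have split: "{P. P \<subseteq> Sigma (insert w W) I \<and> inj_on fst P} = ?A \<union> ?i ` (I w \<times> ?A)"
  proof (intro equalityI subsetI)
    fix P assume "P \<in> {P. P \<subseteq> Sigma (insert w W) I \<and> inj_on fst P}"
    then have P: "P \<subseteq> Sigma (insert w W) I" "inj_on fst P" by auto
    show "P \<in> ?A \<union> ?i ` (I w \<times> ?A)"
    proof (cases "\<exists>e. (w, e) \<in> P")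
      case True
      then obtain e where e: "(w, e) \<in> P" by auto
      have "P - {(w, e)} \<subseteq> Sigma W I"
      proof
        fix z assume z: "z \<in> P - {(w, e)}"
        then have "fst z \<noteq> w" using inj_onD[OF P(2), of z "(w, e)"] e by auto
        then show "z \<in> Sigma W I" using z P(1) by auto
      qed
      moreover have "inj_on fst (P - {(w, e)})" using P(2) by (rule inj_on_subset) auto
      moreover have "P = ?i (e, P - {(w, e)})" using e by auto
      moreover have "e \<in> I w" using e P by auto
      ultimately have "(e, P - {(w, e)}) \<in> I w \<times> ?A" by simp
      then have "?i (e, P - {(w, e)}) \<in> ?i ` (I w \<times> ?A)" by (rule imageI)
      then show ?thesis using \<open>P = ?i (e, P - {(w, e)})\<close> by simp
    next
      case False
      then have "P \<subseteq> Sigma W I" using P(1) by auto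
      then show ?thesis using P(2) by simp
    qed
  next
    fix P assume "P \<in> ?A \<union> ?i ` (I w \<times> ?A)"
    then show "P \<in> {P. P \<subseteq> Sigma (insert w W) I \<and> inj_on fst P}"
    proof
      assume "P \<in> ?A"
      then show ?thesis by auto
    next
      assume "P \<in> ?i ` (I w \<times> ?A)"
      then obtain e P' where P: "e \<in> I w" "P' \<in> ?A" "P = insert (w, e) P'" by auto
      have "inj_on fst (insert (w, e) P')"
        using P(2) insert(2) unfolding inj_on_insert by auto
      then show ?thesis using P by auto
    qed
  qed
  have nw: "(w, e) \<notin> P" if "P \<in> ?A" for e P using that insert(2) by auto
  have inj: "inj_on ?i (I w \<times> ?A)"
  proof (rule inj_onI, clarify)
    fix e P e' P' assume h: "e \<in> I w" "P \<subseteq> Sigma W I" "P' \<subseteq> Sigma W I"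
      and eq: "insert (w, e) P = insert (w, e') P'"
    have n: "(w, y) \<notin> P \<and> (w, y) \<notin> P'" for y using h insert(2) by auto
    have "e = e'" using eq n by blast
    moreover have "P = P'" using eq n \<open>e = e'\<close> by (metis insert_ident)
    ultimately show "e = e' \<and> P = P'" by simp
  qed
  have "(\<Sum>P\<in>?i ` (I w \<times> ?A). ?t (insert w W) P) = (\<Sum>(e, P)\<in>I w \<times> ?A. - ?t W P)"
    unfolding sum.reindex[OF inj] o_def
  proof (rule sum.cong[OF refl], clarify)
    fix e P assume "P \<subseteq> Sigma W I" "inj_on fst P"
    then have PA: "P \<in> ?A" by simp
    show "?t (insert w W) (insert (w, e) P) = - ?t W P"
      using cP[OF PA] nw[OF PA] insert(1,2) by simp
  qed
  also have "\<dots> = - of_nat (card (I w)) * (\<Sum>P\<in>?A. ?t W P)"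
    by (simp add: sum.cartesian_product[symmetric] sum_negf)
  finally have 1: "(\<Sum>P\<in>?i ` (I w \<times> ?A). ?t (insert w W) P) = \<dots>" .
  have 2: "(\<Sum>P\<in>?A. ?t (insert w W) P) = x * (\<Sum>P\<in>?A. ?t W P)"
    unfolding sum_distrib_left
  proof (rule sum.cong[OF refl])
    fix P assume "P \<in> ?A"
    then show "?t (insert w W) P = x * ?t W P"
      using cP[of P] insert(1,2) by (simp add: Suc_diff_le)
  qed
  have "(\<Sum>P | P \<subseteq> Sigma (insert w W) I \<and> inj_on fst P. ?t (insert w W) P)
      = (\<Sum>P\<in>?A. ?t (insert w W) P) + (\<Sum>P\<in>?i ` (I w \<times> ?A). ?t (insert w W) P)"
    unfolding split
    by (rule sum.union_disjoint) (use finA insert nw in \<open>auto simp: finS\<close>)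
  also have "\<dots> = (x - of_nat (card (I w))) * (\<Sum>P\<in>?A. ?t W P)"
    unfolding 1 2 by (simp add: algebra_simps)
  finally show ?case using insert by simp
qed

text \<open>Inserting a fixed element of \<open>D\<close> pairs off subsets of opposite sign. This
  is the cancellation that removes every assignment giving some edge to both of its ends.\<close>

lemma sum_Pow_minus_one:
  assumes "finite D"
  shows "(\<Sum>M\<in>Pow D. (- 1) ^ card M) = (if D = {} then 1 else (0::'c::comm_ring_1))"
  using assms
proof (induction D rule: finite_induct)
  case (insert d D)
  have "(\<Sum>M\<in>Pow (insert d D). (- 1) ^ card M)
      = (\<Sum>M\<in>Pow D. (- 1) ^ card M) + (\<Sum>M\<in>insert d ` Pow D. (- 1 :: 'c) ^ card M)"
    unfolding Pow_insert by (rule sum.union_disjoint) (use insert in auto)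
  also have "(\<Sum>M\<in>insert d ` Pow D. (- 1 :: 'c) ^ card M) = (\<Sum>M\<in>Pow D. - ((- 1) ^ card M))"
    by (rule sum.reindex_cong[where l = "insert d"])
       (use insert in \<open>auto simp: inj_on_def finite_subset card_insert_if\<close>)
  finally show ?case by (simp add: sum_negf)
qed simp

section \<open>Assignments of edges to their ends and the coefficients of the polynomial\<close>

text \<open>A pair \<open>(v, e)\<close> stands for the edge of the subdivision graph between
  \<open>v\<close> and the vertex inserted into \<open>e\<close>.\<close>

definition incidences :: "'a set set \<Rightarrow> ('a \<times> 'a set) set" where
  "incidences F = {(v, e). e \<in> F \<and> v \<in> e}"

text \<open>The first injectivity lets a vertex receive at most one edge, the second lets an edge
  choose at most one end. Together they express the matching condition at the old and at the
  inserted vertices of the subdivision graph.\<close>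

definition partial_choices :: "'a set set \<Rightarrow> ('a \<times> 'a set) set set" where
  "partial_choices F = {Q. Q \<subseteq> incidences F \<and> inj_on fst Q \<and> inj_on snd Q}"

lemma incidences_Sigma:
  assumes "simple_graph G"
  shows "Sigma (verts G) (\<lambda>v. {e \<in> edges G. v \<in> e}) = incidences (edges G)"
  using assms by (auto simp: incidences_def simple_graph_def)

lemma finite_incidences:
  assumes "simple_graph G"
  shows "finite (incidences (edges G))"
  unfolding incidences_Sigma[OF assms, symmetric]
  using assms finite_edges[OF assms] by (auto simp: simple_graph_def)

lemma incidences_mono: "F \<subseteq> F' \<Longrightarrow> incidences F \<subseteq> incidences F'"
  by (auto simp: incidences_def)

text \<open>Since the edges are disjoint, a covered vertex lies on just one of them, so the
  incidences form a partial function with two pairs per edge. This is what allows a matching to be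
  merged into an assignment.\<close>

lemma matching_incidences:
  assumes "simple_graph G" "M \<in> matchings G"
  shows "inj_on fst (incidences M)" "fst ` incidences M = \<Union>M" "card (\<Union>M) = 2 * card M"
proof -
  have M: "M \<subseteq> edges G" "pairwise disjnt M" using assms by (auto simp: matchings_def)
  show "inj_on fst (incidences M)"
    using M(2) by (auto simp: incidences_def inj_on_def pairwise_def disjnt_def)
  show "fst ` incidences M = \<Union>M"
    by (auto simp: incidences_def image_iff)
  have c: "card e = 2" if "e \<in> M" for e using that M assms(1) by (auto simp: simple_graph_def)
  then have "card (\<Union>M) = (\<Sum>e\<in>M. card e)"
    by (intro card_Union_disjoint M(2)) (metis card.infinite zero_neq_numeral)
  then show "card (\<Union>M) = 2 * card M" using c by simp
qed

lemma laplacian_matching_poly_expand: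
  assumes G: "simple_graph G"
  shows "laplacian_matching_poly G =
    (\<Sum>Q\<in>partial_choices (edges G). (- 1) ^ card Q * monom 1 1 ^ (card (verts G) - card Q))"
proof -
  let ?V = "verts G" and ?E = "edges G"
  define X :: "int poly" where "X = monom 1 1"
  define I where "I v = {e \<in> ?E. v \<in> e}" for v
  \<comment> \<open>\<open>\<F>\<close> holds the merged assignments, where an edge may still be
    given to both of its ends; \<open>D Q\<close> collects the edges for which this happens.\<close>
  define \<F> where "\<F> = {Q. Q \<subseteq> incidences ?E \<and> inj_on fst Q}"
  define D where "D Q = {e \<in> ?E. incidences {e} \<subseteq> Q}" for Q
  have finV: "finite ?V" using G by (simp add: simple_graph_def)
  have finE: "finite ?E" using G by (rule finite_edges)
  have finF: "finite \<F>" unfolding \<F>_def using finite_incidences[OF G] by simp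
  have finM: "finite (matchings G)" using finE by (simp add: matchings_def)
  have factor: "[:- int (vdegree G v), 1:] = X - of_nat (card (I v))" for v
    by (simp add: X_def I_def vdegree_def monom_altdef of_nat_poly)
  have inner: "(\<Prod>v\<in>?V - \<Union>M. [:- int (vdegree G v), 1:])
      = (\<Sum>Q | Q \<in> \<F> \<and> incidences M \<subseteq> Q. (- 1) ^ card Q * X ^ (card ?V - card Q))"
    if M: "M \<in> matchings G" for M
  proof -
    note m = matching_incidences[OF G M]
    let ?W = "?V - \<Union>M" and ?I = "incidences M"
    have ME: "M \<subseteq> ?E" using M by (simp add: matchings_def)
    have finI: "finite ?I"
      using finite_incidences[OF G] incidences_mono[OF ME] by (rule finite_subset[rotated])
    have MV: "\<Union>M \<subseteq> ?V" using ME G by (auto simp: simple_graph_def)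
    have cI: "card ?I = 2 * card M" using card_image[OF m(1)] m(2,3) by simp
    have cW: "card ?W = card ?V - 2 * card M"
      using MV finV m(3) by (simp add: card_Diff_subset finite_subset)
    have "(\<Prod>v\<in>?W. [:- int (vdegree G v), 1:])
        = (\<Sum>P | P \<subseteq> Sigma ?W I \<and> inj_on fst P. (- 1) ^ card P * X ^ (card ?W - card P))"
      unfolding factor
      by (rule prod_minus_card_expand) (use finV finE in \<open>auto simp: I_def\<close>)
    also have "\<dots> = (\<Sum>Q | Q \<in> \<F> \<and> ?I \<subseteq> Q. (- 1) ^ card Q * X ^ (card ?V - card Q))"
    proof (rule sum.reindex_bij_witness[where i = "\<lambda>Q. Q - ?I" and j = "\<lambda>P. P \<union> ?I"])
      fix P assume "P \<in> {P. P \<subseteq> Sigma ?W I \<and> inj_on fst P}"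
      then have P: "P \<subseteq> Sigma ?W I" "inj_on fst P" by auto
      have disj: "P \<inter> ?I = {}" using P(1) by (auto simp: incidences_def)
      show "P \<union> ?I - ?I = P" using disj by auto
      have "P \<subseteq> incidences ?E" using P(1) by (auto simp: incidences_def I_def)
      moreover have "inj_on fst (P \<union> ?I)"
        unfolding inj_on_Un using P m(1) by (auto simp: incidences_def)
      ultimately show "P \<union> ?I \<in> {Q. Q \<in> \<F> \<and> ?I \<subseteq> Q}"
        using incidences_mono[OF ME] by (simp add: \<F>_def)
      have "finite P"
        using \<open>P \<subseteq> incidences ?E\<close> finite_incidences[OF G] by (rule finite_subset)
      then have c: "card (P \<union> ?I) = card P + 2 * card M"
        using finI disj cI by (simp add: card_Un_disjoint)
      \<comment> \<open>Merging adds \<open>2 * card M\<close> pairs, so the sign is kept; the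
        exponent is kept too, because \<open>M\<close> covers \<open>2 * card M\<close>
        vertices.\<close>
      show "(- 1) ^ card (P \<union> ?I) * X ^ (card ?V - card (P \<union> ?I))
          = (- 1) ^ card P * X ^ (card ?W - card P)"
        unfolding c cW by (simp add: power_add add.commute)
    next
      fix Q assume "Q \<in> {Q. Q \<in> \<F> \<and> ?I \<subseteq> Q}"
      then have Q: "Q \<subseteq> incidences ?E" "inj_on fst Q" "?I \<subseteq> Q" by (auto simp: \<F>_def)
      show "Q - ?I \<union> ?I = Q" using Q by auto
      have "Q - ?I \<subseteq> Sigma ?W I"
      proof
        fix z assume z: "z \<in> Q - ?I"
        obtain v e where ve: "z = (v, e)" by (cases z)
        have e: "e \<in> ?E" "v \<in> e" using z Q(1) ve by (auto simp: incidences_def)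
        then have "v \<in> ?V" using G by (auto simp: simple_graph_def)
        moreover have "v \<notin> \<Union>M"
        proof
          assume "v \<in> \<Union>M"
          then obtain f where "(v, f) \<in> ?I" by (auto simp: incidences_def)
          then show False using inj_onD[OF Q(2), of "(v, e)" "(v, f)"] z ve Q(3) by auto
        qed
        ultimately show "z \<in> Sigma ?W I" using ve e by (simp add: I_def)
      qed
      moreover have "inj_on fst (Q - ?I)" using Q(2) by (rule inj_on_subset) auto
      ultimately show "Q - ?I \<in> {P. P \<subseteq> Sigma ?W I \<and> inj_on fst P}" by simp
    qed
    finally show ?thesis .
  qed
  \<comment> \<open>Every set of doubly assigned edges is already a matching: two of its edges
    sharing a vertex would both be assigned to that vertex by \<open>Q\<close>.\<close>
  have Pow: "{M \<in> matchings G. incidences M \<subseteq> Q} = Pow (D Q)" if Q: "Q \<in> \<F>" for Q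
  proof (intro equalityI subsetI)
    fix M assume "M \<in> {M \<in> matchings G. incidences M \<subseteq> Q}"
    then show "M \<in> Pow (D Q)"
      by (auto simp: matchings_def D_def incidences_def)
  next
    fix M assume M: "M \<in> Pow (D Q)"
    then have I: "incidences M \<subseteq> Q" by (auto simp: D_def incidences_def)
    have "e = f" if "e \<in> M" "f \<in> M" "v \<in> e" "v \<in> f" for e f v
    proof -
      have "(v, e) \<in> Q" "(v, f) \<in> Q" using that I by (auto simp: incidences_def)
      then show ?thesis using Q inj_onD[of fst Q "(v, e)" "(v, f)"] by (auto simp: \<F>_def)
    qed
    then have "pairwise disjnt M" by (auto simp: pairwise_def disjnt_def)
    then show "M \<in> {M \<in> matchings G. incidences M \<subseteq> Q}"
      using M I by (auto simp: matchings_def D_def)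
  qed
  \<comment> \<open>An edge has exactly two ends, so being assigned to two different vertices is the
    same as being assigned to all of its ends.\<close>
  have DQ: "{Q \<in> \<F>. D Q = {}} = partial_choices ?E"
  proof (intro equalityI subsetI)
    fix Q assume "Q \<in> {Q \<in> \<F>. D Q = {}}"
    then have Q: "Q \<subseteq> incidences ?E" "inj_on fst Q" "D Q = {}" by (auto simp: \<F>_def)
    have "u = v" if "(u, e) \<in> Q" "(v, e) \<in> Q" for u v e
    proof (rule ccontr)
      assume "u \<noteq> v"
      have e: "e \<in> ?E" "u \<in> e" "v \<in> e" using that Q(1) by (auto simp: incidences_def)
      then have "e = {u, v}" using edgeE[OF G e(1,2)] \<open>u \<noteq> v\<close> by blast
      then have "e \<in> D Q" using that e by (auto simp: D_def incidences_def)
      then show False using Q(3) by simp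
    qed
    then have "inj_on snd Q" by (auto simp: inj_on_def)
    then show "Q \<in> partial_choices ?E" using Q by (simp add: partial_choices_def)
  next
    fix Q assume "Q \<in> partial_choices ?E"
    then have Q: "Q \<subseteq> incidences ?E" "inj_on fst Q" "inj_on snd Q"
      by (auto simp: partial_choices_def)
    have "D Q = {}"
    proof (rule ccontr)
      assume "D Q \<noteq> {}"
      then obtain e where e: "e \<in> ?E" "incidences {e} \<subseteq> Q" by (auto simp: D_def)
      have "card e = 2" using e G by (simp add: simple_graph_def)
      then obtain u v where uv: "e = {u, v}" "u \<noteq> v" by (auto simp: card_2_iff)
      then have "(u, e) \<in> Q" "(v, e) \<in> Q" using e by (auto simp: incidences_def)
      then show False using inj_onD[OF Q(3), of "(u, e)" "(v, e)"] uv by auto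
    qed
    then show "Q \<in> {Q \<in> \<F>. D Q = {}}" using Q by (simp add: \<F>_def)
  qed
  let ?t = "\<lambda>Q. (- 1) ^ card Q * X ^ (card ?V - card Q)"
  have "laplacian_matching_poly G
      = (\<Sum>M\<in>matchings G. \<Sum>Q | Q \<in> \<F> \<and> incidences M \<subseteq> Q. (- 1) ^ card M * ?t Q)"
    unfolding laplacian_matching_poly_def by (simp add: inner sum_distrib_left)
  also have "\<dots> = (\<Sum>Q\<in>\<F>. \<Sum>M | M \<in> matchings G \<and> incidences M \<subseteq> Q. (- 1) ^ card M * ?t Q)"
    by (rule sum.swap_restrict[OF finM finF])
  \<comment> \<open>For fixed \<open>Q\<close> only the sign of \<open>M\<close> varies, and
    \<open>M\<close> runs over all subsets of \<open>D Q\<close>, so the alternating sum vanishes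
    unless \<open>D Q\<close> is empty.\<close>
  also have "\<dots> = (\<Sum>Q\<in>\<F>. if D Q = {} then ?t Q else 0)"
  proof (rule sum.cong[OF refl])
    fix Q assume Q: "Q \<in> \<F>"
    have "finite (D Q)" using finE by (simp add: D_def)
    then show "(\<Sum>M | M \<in> matchings G \<and> incidences M \<subseteq> Q. (- 1) ^ card M * ?t Q)
        = (if D Q = {} then ?t Q else 0)"
      unfolding Pow[OF Q] sum_distrib_right[symmetric] by (simp add: sum_Pow_minus_one)
  qed
  also have "\<dots> = (\<Sum>Q\<in>partial_choices ?E. ?t Q)"
    unfolding DQ[symmetric] using finF by (simp add: sum.inter_filter)
  finally show ?thesis by (simp add: X_def)
qed

text \<open>The bound makes the truncated exponent \<open>card (verts G) - card Q\<close> a genuine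
  difference, which therefore determines \<open>card Q\<close>.\<close>

lemma card_le_partial_choices:
  assumes "simple_graph G" "Q \<in> partial_choices (edges G)"
  shows "finite Q" "card Q \<le> card (verts G)"
proof -
  have Q: "Q \<subseteq> incidences (edges G)" "inj_on fst Q"
    using assms by (auto simp: partial_choices_def)
  then show "finite Q" using finite_incidences[OF assms(1)] finite_subset by blast
  have "fst ` Q \<subseteq> verts G"
    using Q(1) unfolding incidences_Sigma[OF assms(1), symmetric] by auto
  then show "card Q \<le> card (verts G)"
    using card_inj_on_le[OF Q(2)] assms(1) by (auto simp: simple_graph_def)
qed

lemma finite_partial_choices: "simple_graph G \<Longrightarrow> finite (partial_choices (edges G))"
  using finite_incidences[of G] by (simp add: partial_choices_def)

lemma coeff_laplacian_matching_poly:
  assumes G: "simple_graph G"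
  shows "coeff (laplacian_matching_poly G) k =
    (\<Sum>Q\<in>partial_choices (edges G). if k = card (verts G) - card Q then (- 1) ^ card Q else 0)"
proof -
  have "coeff ((- 1) ^ m * monom 1 1 ^ d :: int poly) k = (if k = d then (- 1) ^ m else 0)" for m d
  proof -
    have "(- 1 :: int poly) ^ m = [:(- 1) ^ m:]"
      by (induction m) (auto simp: one_pCons)
    then show ?thesis by (simp add: monom_power)
  qed
  then show ?thesis
    by (simp add: laplacian_matching_poly_expand[OF G] coeff_sum)
qed

text \<open>Only assignments with \<open>r\<close> pairs reach this coefficient, all with sign
  \<open>(- 1) ^ r\<close>, which the sign in \<open>lmp_coeff\<close> cancels. For \<open>r\<close>
  beyond the number of vertices, truncation would pick up the constant term again.\<close>

lemma lmp_coeff_eq_card: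
  assumes G: "simple_graph G" and r: "r \<le> card (verts G)"
  shows "lmp_coeff G r = int (card {Q \<in> partial_choices (edges G). card Q = r})"
proof -
  let ?n = "card (verts G)" and ?P = "partial_choices (edges G)"
  have "coeff (laplacian_matching_poly G) (?n - r)
      = (\<Sum>Q\<in>?P. if card Q = r then (- 1) ^ r else 0)"
    unfolding coeff_laplacian_matching_poly[OF G]
  proof (rule sum.cong[OF refl])
    fix Q assume "Q \<in> ?P"
    then have "?n - r = ?n - card Q \<longleftrightarrow> card Q = r"
      using card_le_partial_choices(2)[OF G] r by (metis diff_diff_cancel)
    then show "(if ?n - r = ?n - card Q then (- 1) ^ card Q else 0)
        = (if card Q = r then (- 1) ^ r else (0::int))" by simp
  qed
  also have "\<dots> = (- 1) ^ r * int (card {Q \<in> ?P. card Q = r})"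
    using finite_partial_choices[OF G] by (simp add: sum.inter_filter[symmetric])
  finally show ?thesis
    by (simp add: lmp_coeff_def mult.assoc[symmetric] power_mult_distrib[symmetric])
qed

text \<open>All exponents in the expansion have the form \<open>n - card Q\<close>, so the degree is
  at most \<open>n\<close> and the coefficients up to \<open>n\<close>, read in reverse order,
  recover the whole polynomial.\<close>

lemma laplacian_matching_poly_eq_sum:
  assumes G: "simple_graph G" and n: "card (verts G) = n"
  shows "laplacian_matching_poly G = (\<Sum>r=0..n. monom ((- 1) ^ r * lmp_coeff G r) (n - r))"
proof -
  let ?p = "laplacian_matching_poly G"
  have deg: "degree ?p \<le> n"
    by (rule degree_le) (auto simp: coeff_laplacian_matching_poly[OF G] n intro!: sum.neutral)
  have "(\<Sum>r=0..n. monom ((- 1) ^ r * lmp_coeff G r) (n - r)) = (\<Sum>r=0..n. monom (coeff ?p (n - r)) (n - r))"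
    by (simp add: lmp_coeff_def n mult.assoc[symmetric] power_mult_distrib[symmetric])
  also have "\<dots> = (\<Sum>k\<le>n. monom (coeff ?p k) k)"
    by (rule sum.reindex_bij_witness[where i = "\<lambda>k. n - k" and j = "\<lambda>k. n - k"]) auto
  also have "\<dots> = ?p" by (rule poly_as_sum_of_monoms'[OF deg])
  finally show ?thesis by simp
qed

section \<open>Matchings of the subdivision graph\<close>

text \<open>Incidences correspond bijectively to edges of the subdivision graph. That graph is
  bipartite, so two of its edges are disjoint exactly when their incidences differ in both
  coordinates.\<close>

lemma num_matchings_subdivision:
  "num_matchings (subdivision G) r = card {Q \<in> partial_choices (edges G). card Q = r}"
proof -
  let ?j = "\<lambda>(v, e). {Inl v, Inr e} :: ('a + 'a set) set"
  have inj: "inj ?j" by (auto simp: inj_def doubleton_eq_iff)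
  have E: "edges (subdivision G) = ?j ` incidences (edges G)"
    by (auto simp: subdivision_def incidences_def image_iff)
  have m: "?j ` Q \<in> matchings (subdivision G) \<longleftrightarrow> Q \<in> partial_choices (edges G)" for Q
  proof -
    have "?j ` Q \<subseteq> ?j ` incidences (edges G) \<longleftrightarrow> Q \<subseteq> incidences (edges G)"
      using inj by (rule inj_image_subset_iff)
    moreover have "pairwise disjnt (?j ` Q) \<longleftrightarrow> inj_on fst Q \<and> inj_on snd Q"
    proof -
      have d: "disjnt (?j p) (?j q) \<longleftrightarrow> fst p \<noteq> fst q \<and> snd p \<noteq> snd q" for p q
        by (cases p; cases q) (auto simp: disjnt_def)
      have "pairwise disjnt (?j ` Q)
          \<longleftrightarrow> (\<forall>p\<in>Q. \<forall>q\<in>Q. p \<noteq> q \<longrightarrow> fst p \<noteq> fst q \<and> snd p \<noteq> snd q)"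
        unfolding pairwise_image d inj_eq[OF inj] by (simp add: pairwise_def)
      also have "\<dots> \<longleftrightarrow> inj_on fst Q \<and> inj_on snd Q"
        unfolding inj_on_def by meson
      finally show ?thesis .
    qed
    ultimately show ?thesis by (simp add: matchings_def partial_choices_def E)
  qed
  have "{M \<in> matchings (subdivision G). card M = r}
      = (`) ?j ` {Q \<in> partial_choices (edges G). card Q = r}"
  proof (intro equalityI subsetI)
    fix M assume M: "M \<in> {M \<in> matchings (subdivision G). card M = r}"
    then have "M \<subseteq> ?j ` incidences (edges G)" by (simp add: matchings_def E)
    then obtain Q where "M = ?j ` Q" by (auto simp: subset_image_iff)
    then show "M \<in> (`) ?j ` {Q \<in> partial_choices (edges G). card Q = r}"
      using M m[of Q] card_image[OF inj_on_subset[OF inj subset_UNIV], of Q] by auto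
  next
    fix M assume "M \<in> (`) ?j ` {Q \<in> partial_choices (edges G). card Q = r}"
    then obtain Q where "M = ?j ` Q" "Q \<in> partial_choices (edges G)" "card Q = r" by auto
    then show "M \<in> {M \<in> matchings (subdivision G). card M = r}"
      using m[of Q] card_image[OF inj_on_subset[OF inj subset_UNIV], of Q] by simp
  qed
  moreover have "inj_on ((`) ?j) A" for A
    using inj_image_eq_iff[OF inj] by (auto simp: inj_on_def)
  ultimately show ?thesis by (simp add: num_matchings_def card_image)
qed

section \<open>Connected graphs: spanning trees, edge counts and cycles\<close>

lemma in_adj [simp]: "(u, v) \<in> adj (V, F) \<longleftrightarrow> {u, v} \<in> F"
  by (simp add: adj_def)

lemma sym_adj_rtrancl: "sym ((adj G)\<^sup>*)"
  by (rule sym_rtrancl) (auto simp: sym_def adj_def insert_commute)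

lemma connected_graph_root:
  assumes "r \<in> V"
  shows "connected_graph (V, F) \<longleftrightarrow> (\<forall>v\<in>V. (r, v) \<in> (adj (V, F))\<^sup>*)"
  using assms sym_adj_rtrancl[of "(V, F)"]
  by (auto simp: connected_graph_def) (meson rtrancl_trans symD)

lemma connected_graph_mono:
  assumes "connected_graph (V, F)" "F \<subseteq> F'"
  shows "connected_graph (V, F')"
proof -
  have "(adj (V, F))\<^sup>* \<subseteq> (adj (V, F'))\<^sup>*"
    by (rule rtrancl_mono) (use assms(2) in auto)
  then show ?thesis using assms(1) by (auto simp: connected_graph_def)
qed

lemma simple_graph_mono: "simple_graph (V, F) \<Longrightarrow> F' \<subseteq> F \<Longrightarrow> simple_graph (V, F')"
  by (auto simp: simple_graph_def)

text \<open>The map \<open>p\<close> sends a vertex to the edge towards its parent in a breadth-first search tree.\<close>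

lemma spanning_tree:
  assumes G: "simple_graph (V, F)" and con: "connected_graph (V, F)" and r: "r \<in> V"
  obtains p where "inj_on p (V - {r})" "p ` (V - {r}) \<subseteq> F"
    "\<And>v. v \<in> V - {r} \<Longrightarrow> v \<in> p v" "connected_graph (V, p ` (V - {r}))"
proof -
  let ?A = "adj (V, F)"
  define d where "d v = (LEAST k. (r, v) \<in> ?A ^^ k)" for v
  have d_le: "d v \<le> k" if "(r, v) \<in> ?A ^^ k" for v k
    unfolding d_def using that by (rule Least_le)
  have d: "(r, v) \<in> ?A ^^ d v" if v: "v \<in> V" for v
  proof -
    have "(r, v) \<in> ?A\<^sup>*" using con r v by (simp add: connected_graph_def)
    then obtain k where "(r, v) \<in> ?A ^^ k" by (auto simp: rtrancl_power)
    then show ?thesis unfolding d_def by (rule LeastI)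
  qed
  \<comment> \<open>The last vertex before \<open>v\<close> on a shortest walk from \<open>r\<close>
    is at distance exactly one less, and serves as the parent.\<close>
  have "\<exists>u. {u, v} \<in> F \<and> u \<in> V \<and> Suc (d u) = d v" if v: "v \<in> V - {r}" for v
  proof -
    have dv: "(r, v) \<in> ?A ^^ d v" using d v by auto
    then obtain k where k: "d v = Suc k" using v by (cases "d v") auto
    then obtain u where u: "(r, u) \<in> ?A ^^ k" "(u, v) \<in> ?A"
      using dv by auto
    have "{u, v} \<in> F" using u by simp
    then have uV: "u \<in> V" using G by (auto simp: simple_graph_def)
    have "(r, v) \<in> ?A ^^ Suc (d u)" using d[OF uV] u(2) by auto
    then have "d v \<le> Suc (d u)" by (rule d_le)
    moreover have "d u \<le> k" using u(1) by (rule d_le)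
    ultimately show ?thesis using k uV \<open>{u, v} \<in> F\<close> by auto
  qed
  then obtain q where q: "\<And>v. v \<in> V - {r} \<Longrightarrow> {q v, v} \<in> F \<and> q v \<in> V \<and> Suc (d (q v)) = d v"
    by metis
  let ?p = "\<lambda>v. {q v, v}"
  let ?T = "?p ` (V - {r})"
  \<comment> \<open>Two vertices with the same parent edge would be parents of each other, which
    their distances from \<open>r\<close> forbid.\<close>
  have "inj_on ?p (V - {r})"
  proof (rule inj_onI, rule ccontr)
    fix v w assume vw: "v \<in> V - {r}" "w \<in> V - {r}" "{q v, v} = {q w, w}" "v \<noteq> w"
    then have "q v = w" "q w = v" by (auto simp: doubleton_eq_iff)
    then show False using q[OF vw(1)] q[OF vw(2)] by simp
  qed
  moreover have "?T \<subseteq> F" using q by auto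
  moreover have "connected_graph (V, ?T)"
  proof -
    have "(r, v) \<in> (adj (V, ?T))\<^sup>*" if "v \<in> V" for v
      using that
    proof (induction "d v" arbitrary: v rule: less_induct)
      case less
      show ?case
      proof (cases "v = r")
        case False
        then have v: "v \<in> V - {r}" using less by simp
        then have "(r, q v) \<in> (adj (V, ?T))\<^sup>*" using q[OF v] less(1)[of "q v"] by simp
        moreover have "(q v, v) \<in> adj (V, ?T)" using v by auto
        ultimately show ?thesis by (rule rtrancl_into_rtrancl)
      qed simp
    qed
    then show ?thesis using connected_graph_root[OF r] by blast
  qed
  ultimately show ?thesis by (intro that[of ?p]) auto
qed

text \<open>A spanning tree uses one parent edge for each vertex other than the root. With any
  further edge present, some \<open>f\<close> lies outside the tree and can be deleted without
  disconnecting the graph.\<close>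

lemma connected_card_le:
  assumes G: "simple_graph (V, F)" and con: "connected_graph (V, F)"
  shows "card V \<le> Suc (card F)"
    and "card V \<le> card F \<Longrightarrow> \<exists>f\<in>F. connected_graph (V, F - {f})"
proof -
  obtain r where r: "r \<in> V" using con by (auto simp: connected_graph_def)
  obtain p where p: "inj_on p (V - {r})" "p ` (V - {r}) \<subseteq> F" "connected_graph (V, p ` (V - {r}))"
    using spanning_tree[OF G con r] by metis
  have fin: "finite V" "finite F" using G finite_edges[OF G] by (auto simp: simple_graph_def)
  then have V: "card V > 0" using r by (auto simp: card_gt_0_iff)
  have c: "card (p ` (V - {r})) = card V - 1" using r fin by (simp add: card_image[OF p(1)])
  have "card V - 1 \<le> card F" using card_mono[OF fin(2) p(2)] c by simp
  then show "card V \<le> Suc (card F)" by simp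
  assume "card V \<le> card F"
  then have "p ` (V - {r}) \<noteq> F" using c V by auto
  then obtain f where f: "f \<in> F" "f \<notin> p ` (V - {r})" using p(2) by blast
  have "p ` (V - {r}) \<subseteq> F - {f}" using p(2) f(2) by blast
  from connected_graph_mono[OF p(3) this] f(1)
  show "\<exists>f\<in>F. connected_graph (V, F - {f})" by blast
qed

lemma cycles_remove: "cycles (V, F - {f}) = {C \<in> cycles (V, F). f \<notin> C}"
  unfolding cycles_def by auto

lemma cycle_nonempty: "C \<in> cycles G \<Longrightarrow> C \<noteq> {}"
  unfolding cycles_def cycle_edges_def by fastforce

lemma cycle_subset_edges: "C \<in> cycles (V, F) \<Longrightarrow> C \<subseteq> F"
  unfolding cycles_def by auto

text \<open>The rest of the cycle is a detour between the ends of \<open>f\<close>, so each use of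
  \<open>f\<close> in a walk can be replaced.\<close>

lemma connected_remove_cycle_edge:
  assumes C: "C \<in> cycles (V, F)" and f: "f \<in> C" and con: "connected_graph (V, F)"
  shows "connected_graph (V, F - {f})"
proof -
  let ?A = "adj (V, F - {f})"
  obtain xs where xs: "3 \<le> length xs" "distinct xs" "cycle_edges xs \<subseteq> F" "C = cycle_edges xs"
    using C by (auto simp: cycles_def)
  define k where "k = length xs"
  have k: "3 \<le> k" using xs k_def by simp
  obtain i where i: "i < k" "f = {xs ! i, xs ! (Suc i mod k)}"
    using f xs(4) by (auto simp: cycle_edges_def k_def)
  \<comment> \<open>The cycle is listed from the end of \<open>f\<close> that follows it, so that
    \<open>g 0\<close> and \<open>g (k - 1)\<close> are the two ends of \<open>f\<close> and the
    walk between them goes the other way round.\<close>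
  define g where "g j = xs ! ((Suc i + j) mod k)" for j
  have step: "(g j, g (Suc j)) \<in> ?A" if j: "Suc j < k" for j
  proof -
    define m where "m = (Suc i + j) mod k"
    have m: "m < k" using k by (simp add: m_def)
    have gS: "g (Suc j) = xs ! (Suc m mod k)" by (simp add: g_def m_def mod_Suc_eq)
    have "{xs ! m, xs ! (Suc m mod k)} \<in> cycle_edges xs"
      using m by (auto simp: cycle_edges_def k_def)
    then have "{xs ! m, xs ! (Suc m mod k)} \<in> F" using xs by auto
    \<comment> \<open>As the vertices are distinct, equality would mean \<open>m = i\<close>, which
      \<open>Suc j < k\<close> excludes, or the same edge traversed backwards, for which
      \<open>k\<close> would have to divide 2.\<close>
    moreover have "{xs ! m, xs ! (Suc m mod k)} \<noteq> f"
    proof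
      assume "{xs ! m, xs ! (Suc m mod k)} = f"
      then have "(xs ! m = xs ! i) \<or> (xs ! m = xs ! (Suc i mod k) \<and> xs ! (Suc m mod k) = xs ! i)"
        using i by (auto simp: doubleton_eq_iff)
      moreover have "xs ! a = xs ! b \<longleftrightarrow> a = b" if "a < k" "b < k" for a b
        using that xs(2) by (simp add: nth_eq_iff_index_eq k_def)
      ultimately have "m = i \<or> (m = Suc i mod k \<and> Suc m mod k = i)"
        using m i(1) by auto
      moreover have "m \<noteq> i"
      proof (cases "Suc i + j < k")
        case False
        then have "m = Suc i + j - k"
          using i(1) j unfolding m_def by (simp add: le_mod_geq)
        then show ?thesis using j False by simp
      qed (simp add: m_def)
      ultimately show False using i(1) k by (auto simp: mod_Suc split: if_splits)
    qed
    ultimately show ?thesis unfolding gS by (simp add: g_def m_def)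
  qed
  have reach: "(g 0, g j) \<in> ?A\<^sup>*" if "j < k" for j
    using that
  proof (induction j)
    case (Suc j)
    then show ?case using step[of j] by (meson Suc_lessD rtrancl_into_rtrancl)
  qed simp
  have "g (k - 1) = xs ! i" using i(1) k by (simp add: g_def)
  then have ends: "(xs ! (Suc i mod k), xs ! i) \<in> ?A\<^sup>*" "(xs ! i, xs ! (Suc i mod k)) \<in> ?A\<^sup>*"
    using reach[of "k - 1"] k symD[OF sym_adj_rtrancl] by (auto simp: g_def)
  have "adj (V, F) \<subseteq> ?A\<^sup>*"
  proof
    fix z assume z: "z \<in> adj (V, F)"
    obtain u v where uv: "z = (u, v)" by (cases z)
    show "z \<in> ?A\<^sup>*"
    proof (cases "{u, v} = f")
      case True
      then show ?thesis using ends i(2) uv by (auto simp: doubleton_eq_iff)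
    next
      case False
      then have "z \<in> ?A" using z uv by simp
      then show ?thesis ..
    qed
  qed
  then have "(adj (V, F))\<^sup>* \<subseteq> ?A\<^sup>*" by (rule rtrancl_subset_rtrancl)
  then show ?thesis using con by (auto simp: connected_graph_def)
qed

text \<open>A path between the ends of \<open>f\<close> that avoids \<open>f\<close> is closed to a
  cycle by \<open>f\<close> itself.\<close>

lemma cycle_through_non_bridge:
  assumes G: "simple_graph (V, F)" and f: "f \<in> F" and con: "connected_graph (V, F - {f})"
  shows "cycles (V, F) \<noteq> {}"
proof -
  let ?r = "\<lambda>x y. (x, y) \<in> adj (V, F - {f})"
  obtain a b where ab: "f = {a, b}" "a \<noteq> b"
    using G f by (auto simp: simple_graph_def card_2_iff)
  then have "a \<in> V" "b \<in> V" using G f by (auto simp: simple_graph_def)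
  then have "(a, b) \<in> (adj (V, F - {f}))\<^sup>*" using con by (simp add: connected_graph_def)
  then have "?r\<^sup>*\<^sup>* a b" by (simp add: rtranclp_rtrancl_eq del: in_adj)
  then obtain ys where "rtrancl_path ?r a ys b" by (auto simp: rtranclp_eq_rtrancl_path)
  then obtain xs where p: "rtrancl_path ?r a xs b" and dist: "distinct (a # xs)"
    by (rule rtrancl_path_distinct)
  have ne: "xs \<noteq> []" using p ab(2) by (auto elim: rtrancl_path.cases)
  then have last: "last xs = b" using p by (rule rtrancl_path_last[rotated])
  have edge: "{(a # xs) ! i, xs ! i} \<in> F - {f}" if "i < length xs" for i
    using rtrancl_path_nth[OF p that] by simp
  \<comment> \<open>A path with a single edge would be \<open>f\<close>, which has been deleted;
    hence the closed path has at least three vertices.\<close>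
  have "length xs \<noteq> 1"
  proof
    assume "length xs = 1"
    then have "xs ! 0 = b" using last ne by (simp add: last_conv_nth)
    then show False using edge[of 0] ne ab(1) by simp
  qed
  moreover have "length xs \<noteq> 0" using ne by simp
  ultimately have "2 \<le> length xs" by linarith
  then have len: "3 \<le> length (a # xs)" by simp
  have E: "{(a # xs) ! i, (a # xs) ! (Suc i mod length (a # xs))} \<in> F"
    if i: "i < length (a # xs)" for i
  proof (cases "i < length xs")
    case True
    then show ?thesis using edge[OF True] by simp
  next
    \<comment> \<open>The wrap-around edge from the last vertex \<open>b\<close> back to
      \<open>a\<close> is \<open>f\<close>.\<close>
    case False
    then have "i = length xs" using i by simp
    then have "(a # xs) ! i = b" using last ne by (simp add: last_conv_nth nth_Cons')
    then show ?thesis using \<open>i = length xs\<close> f ab(1) by (simp add: insert_commute)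
  qed
  then have sub: "cycle_edges (a # xs) \<subseteq> F" unfolding cycle_edges_def by blast
  have inV: "e \<subseteq> V" if "e \<in> F" for e
    using G that by (simp add: simple_graph_def)
  have "set (a # xs) \<subseteq> V"
  proof
    fix x assume "x \<in> set (a # xs)"
    then obtain i where "i < length (a # xs)" "x = (a # xs) ! i" by (metis in_set_conv_nth)
    then have "x \<in> {(a # xs) ! i, (a # xs) ! (Suc i mod length (a # xs))}" by simp
    moreover have "{(a # xs) ! i, (a # xs) ! (Suc i mod length (a # xs))} \<subseteq> V"
      using E[OF \<open>i < length (a # xs)\<close>] by (rule inV)
    ultimately show "x \<in> V" by blast
  qed
  then have "cycle_edges (a # xs) \<in> cycles (V, F)"
    using len dist sub unfolding cycles_def mem_Collect_eq
    by (intro exI[of _ "a # xs"]) simp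
  then show ?thesis by blast
qed

text \<open>Without cycles no edge can be deleted while keeping the graph connected, so there are
  too few edges for a surplus. Conversely, deleting an edge of a cycle from a graph with
  \<open>card V = Suc (card F)\<close> would leave a connected graph below the minimal edge
  count.\<close>

lemma connected_acyclic_iff_card:
  assumes G: "simple_graph (V, F)" and con: "connected_graph (V, F)"
  shows "cycles (V, F) = {} \<longleftrightarrow> card V = Suc (card F)"
proof
  assume "cycles (V, F) = {}"
  then have "\<not> card V \<le> card F"
    using connected_card_le(2)[OF G con] cycle_through_non_bridge[OF G] by blast
  then show "card V = Suc (card F)" using connected_card_le(1)[OF G con] by simp
next
  assume card: "card V = Suc (card F)"
  show "cycles (V, F) = {}"
  proof (rule ccontr)
    assume "cycles (V, F) \<noteq> {}"
    then obtain C f where C: "C \<in> cycles (V, F)" "f \<in> C" using cycle_nonempty by blast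
    then have f: "f \<in> F" using cycle_subset_edges by blast
    have "card V \<le> Suc (card (F - {f}))"
      using connected_card_le(1)[OF simple_graph_mono[OF G] connected_remove_cycle_edge[OF C con]]
      by blast
    moreover have "Suc (card (F - {f})) = card F"
      by (rule card_Suc_Diff1) (use f finite_edges[OF G] in auto)
    ultimately show False using card by simp
  qed
qed

text \<open>Deleting an edge of a cycle keeps the graph connected, so the edge count decides whether
  the remainder is acyclic.\<close>

lemma connected_unicyclic_iff_card:
  assumes G: "simple_graph (V, F)" and con: "connected_graph (V, F)"
  shows "(\<exists>!C. C \<in> cycles (V, F)) \<longleftrightarrow> card V = card F"
proof -
  have rem: "C' \<in> cycles (V, F) \<and> f \<notin> C' \<longleftrightarrow> C' \<in> cycles (V, F - {f})" for C' f
    by (simp add: cycles_remove)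
  have iff: "cycles (V, F - {f}) = {} \<longleftrightarrow> card V = card F"
    if C: "C \<in> cycles (V, F)" "f \<in> C" for C f
  proof -
    have "f \<in> F" using C cycle_subset_edges by blast
    then have "Suc (card (F - {f})) = card F"
      by (intro card_Suc_Diff1) (use finite_edges[OF G] in auto)
    moreover have "simple_graph (V, F - {f})" using G by (rule simple_graph_mono) auto
    ultimately show ?thesis
      using connected_acyclic_iff_card[OF _ connected_remove_cycle_edge[OF C con]] by simp
  qed
  show ?thesis
  proof
    assume "\<exists>!C. C \<in> cycles (V, F)"
    then obtain C where C: "C \<in> cycles (V, F)" "\<And>C'. C' \<in> cycles (V, F) \<Longrightarrow> C' = C" by blast
    then obtain f where f: "f \<in> C" using cycle_nonempty by blast
    have "cycles (V, F - {f}) = {}" using C(2) f rem[of _ f] by blast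
    then show "card V = card F" using iff[OF C(1) f] by simp
  next
    assume card: "card V = card F"
    then have "cycles (V, F) \<noteq> {}" using connected_acyclic_iff_card[OF G con] by simp
    \<comment> \<open>Deleting any edge of \<open>C\<close> destroys all cycles, so every cycle
      contains that edge; by symmetry all cycles coincide.\<close>
    moreover have "C \<subseteq> C'" if "C \<in> cycles (V, F)" "C' \<in> cycles (V, F)" for C C'
      using iff[OF that(1)] rem[of C'] card that(2) by blast
    ultimately show "\<exists>!C. C \<in> cycles (V, F)" by blast
  qed
qed

section \<open>Counting injective choices of ends on a connected graph\<close>

text \<open>Directing each edge towards its chosen end turns these, for a simple graph, into the
  orientations of \<open>F\<close> with all indegrees at most one.\<close>

definition choices :: "'a set set \<Rightarrow> ('a \<times> 'a set) set set" where
  "choices F = {Q \<in> partial_choices F. snd ` Q = F}"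

lemma choicesD:
  assumes "Q \<in> choices F"
  shows "inj_on fst Q" "inj_on snd Q" "snd ` Q = F"
    "\<And>v e. (v, e) \<in> Q \<Longrightarrow> e \<in> F" "\<And>v e. (v, e) \<in> Q \<Longrightarrow> v \<in> e"
    "\<And>e. e \<in> F \<Longrightarrow> \<exists>v. (v, e) \<in> Q"
    "\<And>v e f. (v, e) \<in> Q \<Longrightarrow> (v, f) \<in> Q \<Longrightarrow> e = f"
proof -
  show inj: "inj_on fst Q" and "inj_on snd Q" "snd ` Q = F"
    "\<And>v e. (v, e) \<in> Q \<Longrightarrow> e \<in> F" "\<And>v e. (v, e) \<in> Q \<Longrightarrow> v \<in> e"
    "\<And>e. e \<in> F \<Longrightarrow> \<exists>v. (v, e) \<in> Q"
    using assms by (auto simp: choices_def partial_choices_def incidences_def)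
  show "\<And>v e f. (v, e) \<in> Q \<Longrightarrow> (v, f) \<in> Q \<Longrightarrow> e = f"
    using inj_onD[OF inj] by fastforce
qed

lemma choicesI:
  assumes "\<And>v e. (v, e) \<in> Q \<Longrightarrow> v \<in> e" "inj_on fst Q" "inj_on snd Q" "snd ` Q = F"
  shows "Q \<in> choices F"
  using assms by (auto simp: choices_def partial_choices_def incidences_def intro: rev_image_eqI)

lemma card_choice:
  assumes "Q \<in> choices F"
  shows "card Q = card F" "card (fst ` Q) = card F"
proof -
  show "card Q = card F" using card_image[of snd Q] choicesD(2,3)[OF assms] by simp
  then show "card (fst ` Q) = card F" using card_image[of fst Q] choicesD(1)[OF assms] by simp
qed

lemma fst_choice_subset:
  assumes "simple_graph (V, F)" "Q \<in> choices F"
  shows "fst ` Q \<subseteq> V"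
  using assms(1) choicesD(4,5)[OF assms(2)] by (fastforce simp: simple_graph_def)

lemma finite_choices:
  assumes "simple_graph (V, F)"
  shows "finite (choices F)"
  using finite_partial_choices[OF assms] by (simp add: choices_def)

text \<open>If no edge chooses \<open>r\<close>, every edge chooses its endpoint away from \<open>r\<close>, so the choice
  is forced.\<close>

lemma choices_eq_if_missing:
  assumes G: "simple_graph (V, F)" and con: "connected_graph (V, F)" and r: "r \<in> V"
    and Q: "Q \<in> choices F" "r \<notin> fst ` Q" and Q': "Q' \<in> choices F" "r \<notin> fst ` Q'"
  shows "Q = Q'"
proof -
  \<comment> \<open>\<open>T\<close> consists of the steps along edges that both choices give to the
    far end. The aim is to reach every vertex from \<open>r\<close> by such steps.\<close>
  define T where "T = {(u, v). (v, {u, v}) \<in> Q \<and> (v, {u, v}) \<in> Q'}"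
  have one: "(v, {v, w}) \<in> P \<or> (w, {v, w}) \<in> P" if "P \<in> choices F" "{v, w} \<in> F" for P v w
    using choicesD(5,6)[OF that(1)] that(2) by blast
  have key: "(r, w) \<in> T\<^sup>* \<and> ((v, {v, w}) \<in> Q \<longleftrightarrow> (v, {v, w}) \<in> Q')"
    if rv: "(r, v) \<in> T\<^sup>*" and e: "{v, w} \<in> F" for v w
  proof -
    have vw: "v \<noteq> w" using e G by (auto simp: simple_graph_def)
    \<comment> \<open>Here \<open>v\<close> differs from \<open>r\<close> and was reached by a
      \<open>T\<close>-step from some \<open>u\<close>, so both choices already give it the edge to
      \<open>u\<close>. A vertex receives only one edge, hence \<open>u = w\<close>.\<close>
    have forced: "(r, w) \<in> T\<^sup>* \<and> (v, {v, w}) \<in> Q \<and> (v, {v, w}) \<in> Q'"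
      if v: "(v, {v, w}) \<in> P" and P: "P = Q \<or> P = Q'" for P
    proof -
      have "v \<noteq> r" using v P Q(2) Q'(2) by force
      then obtain u where u: "(r, u) \<in> T\<^sup>*" "(u, v) \<in> T" using rv by (auto elim: rtranclE)
      then have T: "(v, {u, v}) \<in> Q" "(v, {u, v}) \<in> Q'" by (auto simp: T_def)
      have "{u, v} = {v, w}"
        using P
      proof
        assume "P = Q"
        then show ?thesis using choicesD(7)[OF Q(1) T(1)] v by simp
      next
        assume "P = Q'"
        then show ?thesis using choicesD(7)[OF Q'(1) T(2)] v by simp
      qed
      then have "u = w" using vw by (auto simp: doubleton_eq_iff)
      then show ?thesis using u(1) T by (simp add: insert_commute)
    qed
    show ?thesis
    proof (cases "(v, {v, w}) \<in> Q \<or> (v, {v, w}) \<in> Q'")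
      case True
      then show ?thesis using forced by blast
    next
      case False
      \<comment> \<open>Neither choice gives the edge to \<open>v\<close>, so both give it to
        \<open>w\<close>.\<close>
      then have "(v, w) \<in> T" using one[OF Q(1) e] one[OF Q'(1) e] by (auto simp: T_def)
      then show ?thesis using rv False by (meson rtrancl_into_rtrancl)
    qed
  qed
  have reach: "(r, v) \<in> T\<^sup>*" if "v \<in> V" for v
  proof -
    have "(r, v) \<in> (adj (V, F))\<^sup>*" using con r that by (simp add: connected_graph_def)
    then show ?thesis
    proof (induction rule: rtrancl_induct)
      case (step v w)
      then show ?case using key[of v w] by simp
    qed simp
  qed
  have "(v, e) \<in> Q \<longleftrightarrow> (v, e) \<in> Q'" for v e
  proof (cases "e \<in> F \<and> v \<in> e")
    case True
    then obtain w where "e = {v, w}" "v \<in> V" using edgeE[OF G, of e v] by auto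
    then show ?thesis using key[OF reach, of v w] True by auto
  next
    case False
    then show ?thesis using choicesD(4,5)[OF Q(1)] choicesD(4,5)[OF Q'(1)] by blast
  qed
  then show ?thesis by auto
qed

text \<open>By the edge count, the parent edges of a spanning tree rooted at \<open>r\<close>
  exhaust \<open>F\<close>; each vertex other than \<open>r\<close> is then chosen by its parent
  edge.\<close>

lemma ex_choice_missing:
  assumes G: "simple_graph (V, F)" and con: "connected_graph (V, F)" and r: "r \<in> V"
    and card: "card V = Suc (card F)"
  obtains Q where "Q \<in> choices F" "r \<notin> fst ` Q"
proof -
  obtain p where p: "inj_on p (V - {r})" "p ` (V - {r}) \<subseteq> F" "\<And>v. v \<in> V - {r} \<Longrightarrow> v \<in> p v"
    using spanning_tree[OF G con r] by metis
  have fin: "finite V" "finite F" using G finite_edges[OF G] by (auto simp: simple_graph_def)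
  have "card (p ` (V - {r})) = card F" using r fin card by (simp add: card_image[OF p(1)])
  then have F: "p ` (V - {r}) = F" using p(2) fin by (simp add: card_subset_eq)
  let ?Q = "(\<lambda>v. (v, p v)) ` (V - {r})"
  have "?Q \<in> choices F"
    by (rule choicesI) (use p F in \<open>auto simp: inj_on_def image_image\<close>)
  moreover have "r \<notin> fst ` ?Q" by auto
  ultimately show ?thesis by (rule that)
qed

text \<open>With one edge fewer than vertices, each choice leaves exactly one vertex unchosen.
  Conversely, each vertex is left out by exactly one choice, so \<open>miss\<close> is a
  bijection.\<close>

lemma card_choices_tree:
  assumes G: "simple_graph (V, F)" and con: "connected_graph (V, F)"
    and card: "card V = Suc (card F)"
  shows "card (choices F) = card V"
proof -
  have finV: "finite V" using G by (simp add: simple_graph_def)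
  define miss where "miss r = (THE Q. Q \<in> choices F \<and> r \<notin> fst ` Q)" for r
  have miss: "Q \<in> choices F \<and> r \<notin> fst ` Q \<longleftrightarrow> Q = miss r" if r: "r \<in> V" for r Q
  proof -
    have "\<exists>!Q. Q \<in> choices F \<and> r \<notin> fst ` Q"
      using ex_choice_missing[OF G con r card] choices_eq_if_missing[OF G con r] by metis
    from theI'[OF this] this show ?thesis unfolding miss_def[symmetric] by blast
  qed
  have ex1: "card (V - fst ` Q) = 1" if "Q \<in> choices F" for Q
    using fst_choice_subset[OF G that] card_choice(2)[OF that] card finV
    by (simp add: card_Diff_subset finite_subset)
  have "bij_betw miss V (choices F)"
  proof (rule bij_betw_imageI)
    show "inj_on miss V"
    proof (rule inj_onI)
      fix r s assume rs: "r \<in> V" "s \<in> V" "miss r = miss s"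
      then have *: "r \<in> V - fst ` miss r" "s \<in> V - fst ` miss r" "miss r \<in> choices F"
        using miss[of r "miss r"] miss[of s "miss s"] by auto
      obtain x where "V - fst ` miss r = {x}"
        using ex1[OF *(3)] by (rule card_1_singletonE)
      then have "r \<in> {x}" "s \<in> {x}" using *(1,2) by (simp_all only:)
      then show "r = s" by simp
    qed
    show "miss ` V = choices F"
    proof (intro equalityI subsetI)
      fix Q assume Q: "Q \<in> choices F"
      then obtain r where "r \<in> V - fst ` Q" using ex1[OF Q] by (metis card_1_singletonE singletonI)
      then show "Q \<in> miss ` V" using miss[of r Q] Q by auto
    qed (use miss in auto)
  qed
  then show ?thesis by (simp add: bij_betw_same_card)
qed

text \<open>Choices for a unicyclic graph are obtained from a spanning tree by rooting it at either end of
  the one remaining edge \<open>f\<close>.\<close>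

lemma card_choices_unicyclic:
  assumes G: "simple_graph (V, F)" and con: "connected_graph (V, F)"
    and card: "card V = card F"
  shows "card (choices F) = 2"
proof -
  obtain f where f: "f \<in> F" and con': "connected_graph (V, F - {f})"
    using connected_card_le(2)[OF G con] card by auto
  let ?F = "F - {f}"
  have G': "simple_graph (V, ?F)" using G by (rule simple_graph_mono) auto
  have "Suc (card ?F) = card F"
    by (rule card_Suc_Diff1) (use f finite_edges[OF G] in auto)
  then have card': "card V = Suc (card ?F)" using card by simp
  obtain a b where ab: "f = {a, b}" "a \<noteq> b" using G f by (auto simp: simple_graph_def card_2_iff)
  then have V: "a \<in> V" "b \<in> V" using G f by (auto simp: simple_graph_def)
  obtain A where A: "A \<in> choices ?F" "a \<notin> fst ` A" by (rule ex_choice_missing[OF G' con' V(1) card'])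
  obtain B where B: "B \<in> choices ?F" "b \<notin> fst ` B" by (rule ex_choice_missing[OF G' con' V(2) card'])
  have ext: "insert (c, f) Q \<in> choices F" if "Q \<in> choices ?F" "c \<notin> fst ` Q" "c \<in> f" for c Q
  proof (rule choicesI)
    note q = choicesD[OF that(1)]
    show "v \<in> e" if "(v, e) \<in> insert (c, f) Q" for v e
      using that q(5) \<open>c \<in> f\<close> by auto
    show "inj_on fst (insert (c, f) Q)" using q(1) that(2) by (auto simp: inj_on_insert)
    have "f \<notin> snd ` Q" using q(3) by simp
    then show "inj_on snd (insert (c, f) Q)" using q(2) by (auto simp: inj_on_insert)
    show "snd ` insert (c, f) Q = F" using q(3) f by auto
  qed
  \<comment> \<open>Since \<open>c\<close> is chosen by \<open>f\<close> and by no other edge,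
    removing this pair leaves a choice on the spanning tree that misses \<open>c\<close>.\<close>
  have restr: "Q - {(c, f)} \<in> choices ?F \<and> c \<notin> fst ` (Q - {(c, f)})"
    if Q: "Q \<in> choices F" "(c, f) \<in> Q" for c Q
  proof
    note q = choicesD[OF Q(1)]
    show "Q - {(c, f)} \<in> choices ?F"
    proof (rule choicesI)
      show "inj_on fst (Q - {(c, f)})" "inj_on snd (Q - {(c, f)})"
        using q(1,2) by (auto intro: inj_on_subset)
      show "snd ` (Q - {(c, f)}) = ?F"
        using inj_on_image_set_diff[OF q(2), of Q "{(c, f)}"] q(3) Q(2) by simp
    qed (use q(5) in auto)
    show "c \<notin> fst ` (Q - {(c, f)})"
      using inj_on_image_set_diff[OF q(1), of Q "{(c, f)}"] Q(2) by simp
  qed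
  have "choices F = {insert (a, f) A, insert (b, f) B}"
  proof (intro equalityI subsetI)
    fix Q assume Q: "Q \<in> choices F"
    then obtain c where c: "(c, f) \<in> Q" "c \<in> f" using choicesD(5,6)[OF Q] f by blast
    have eq: "insert (c, f) (Q - {(c, f)}) = Q" using c(1) by auto
    from c(2) ab consider "c = a" | "c = b" by auto
    then show "Q \<in> {insert (a, f) A, insert (b, f) B}"
    proof cases
      case 1
      then have "Q - {(c, f)} = A"
        using choices_eq_if_missing[OF G' con' V(1) _ _ A] restr[OF Q c(1)] by blast
      then show ?thesis using eq 1 by auto
    next
      case 2
      then have "Q - {(c, f)} = B"
        using choices_eq_if_missing[OF G' con' V(2) _ _ B] restr[OF Q c(1)] by blast
      then show ?thesis using eq 2 by auto
    qed
  next
    fix Q assume "Q \<in> {insert (a, f) A, insert (b, f) B}"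
    then show "Q \<in> choices F" using ext[OF A] ext[OF B] ab by auto
  qed
  moreover have "insert (a, f) A \<noteq> insert (b, f) B"
    using choicesD(4)[OF B(1), of a f] ab(2) by auto
  ultimately show ?thesis by simp
qed

text \<open>Pigeonhole: the chosen ends would be \<open>card F\<close> distinct vertices in
  \<open>V\<close>.\<close>

lemma choices_empty_if_card_less:
  assumes G: "simple_graph (V, F)" and card: "card V < card F"
  shows "choices F = {}"
proof (rule ccontr)
  assume "choices F \<noteq> {}"
  then obtain Q where Q: "Q \<in> choices F" by blast
  have "finite V" using G by (simp add: simple_graph_def)
  then show False
    using card_mono[OF _ fst_choice_subset[OF G Q]] card_choice(2)[OF Q] card by simp
qed

text \<open>Among connected graphs, trees and unicyclic graphs are those with one vertex more than
  edges and with equally many. All others therefore have more edges than vertices.\<close>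

lemma card_choices_connected:
  assumes K: "simple_graph K" "connected_graph K"
  shows "is_tree K \<Longrightarrow> card (choices (edges K)) = card (verts K)"
    and "is_unicyclic K \<Longrightarrow> card (choices (edges K)) = 2"
    and "\<not> is_tree K \<Longrightarrow> \<not> is_unicyclic K \<Longrightarrow> card (choices (edges K)) = 0"
proof -
  obtain V F where [simp]: "K = (V, F)" by (cases K)
  note K' = K[simplified]
  note tree = connected_acyclic_iff_card[OF K'] and uni = connected_unicyclic_iff_card[OF K']
  show "is_tree K \<Longrightarrow> card (choices (edges K)) = card (verts K)"
    using card_choices_tree[OF K'] tree by (simp add: is_tree_def)
  show "is_unicyclic K \<Longrightarrow> card (choices (edges K)) = 2"
    using card_choices_unicyclic[OF K'] uni by (simp add: is_unicyclic_def)
  assume "\<not> is_tree K" "\<not> is_unicyclic K"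
  then have "card V < card F"
    using connected_card_le(1)[OF K'] tree uni K' by (auto simp: is_tree_def is_unicyclic_def)
  then show "card (choices (edges K)) = 0"
    using choices_empty_if_card_less[OF K'(1)] by simp
qed

section \<open>Choices on disjoint unions and on connected components\<close>

lemma choices_restrict:
  assumes "Q \<in> choices F" "F' \<subseteq> F"
  shows "{z \<in> Q. snd z \<in> F'} \<in> choices F'"
proof (rule choicesI)
  note q = choicesD[OF assms(1)]
  show "v \<in> e" if "(v, e) \<in> {z \<in> Q. snd z \<in> F'}" for v e using that q(5) by auto
  show "inj_on fst {z \<in> Q. snd z \<in> F'}" "inj_on snd {z \<in> Q. snd z \<in> F'}"
    using q(1,2) by (auto intro: inj_on_subset)
  show "snd ` {z \<in> Q. snd z \<in> F'} = F'" using q(3) assms(2) by blast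
qed

text \<open>Edges from different sets never compete for a vertex, so the two choices can be made
  independently and are recovered by restriction.\<close>

lemma card_choices_Un:
  assumes disj: "\<Union>F \<inter> \<Union>F' = {}" "F \<inter> F' = {}"
  shows "card (choices (F \<union> F')) = card (choices F) * card (choices F')"
proof -
  have part: "{z \<in> A \<union> B. snd z \<in> F} = A" "{z \<in> A \<union> B. snd z \<in> F'} = B"
    if "A \<in> choices F" "B \<in> choices F'" for A B
    using choicesD(3)[OF that(1)] choicesD(3)[OF that(2)] disj(2) by auto
  have un: "A \<union> B \<in> choices (F \<union> F')" if A: "A \<in> choices F" and B: "B \<in> choices F'" for A B
  proof (rule choicesI)
    note a = choicesD[OF A] and b = choicesD[OF B]
    show "v \<in> e" if "(v, e) \<in> A \<union> B" for v e using that a(5) b(5) by blast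
    have "fst ` A \<subseteq> \<Union>F" "fst ` B \<subseteq> \<Union>F'"
      using a(4,5) b(4,5) by fastforce+
    then have "fst ` A \<inter> fst ` B = {}" using disj(1) by blast
    then show "inj_on fst (A \<union> B)" using a(1) b(1) by (auto simp: inj_on_Un)
    have "snd ` A \<inter> snd ` B = {}" using a(3) b(3) disj(2) by simp
    then show "inj_on snd (A \<union> B)" using a(2) b(2) by (auto simp: inj_on_Un)
    show "snd ` (A \<union> B) = F \<union> F'" using a(3) b(3) by (simp add: image_Un)
  qed
  have "bij_betw (\<lambda>(A, B). A \<union> B) (choices F \<times> choices F') (choices (F \<union> F'))"
  proof (rule bij_betw_byWitness[where f' = "\<lambda>Q. ({z \<in> Q. snd z \<in> F}, {z \<in> Q. snd z \<in> F'})"])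
    show "\<forall>p\<in>choices F \<times> choices F'.
        (\<lambda>Q. ({z \<in> Q. snd z \<in> F}, {z \<in> Q. snd z \<in> F'})) ((\<lambda>(A, B). A \<union> B) p) = p"
    proof
      fix p assume "p \<in> choices F \<times> choices F'"
      then obtain A B where "p = (A, B)" "A \<in> choices F" "B \<in> choices F'" by auto
      then show "(\<lambda>Q. ({z \<in> Q. snd z \<in> F}, {z \<in> Q. snd z \<in> F'})) ((\<lambda>(A, B). A \<union> B) p) = p"
        using part[of A B] by simp
    qed
    show "\<forall>Q\<in>choices (F \<union> F').
        (\<lambda>(A, B). A \<union> B) ({z \<in> Q. snd z \<in> F}, {z \<in> Q. snd z \<in> F'}) = Q"
    proof
      fix Q assume Q: "Q \<in> choices (F \<union> F')"
      show "(\<lambda>(A, B). A \<union> B) ({z \<in> Q. snd z \<in> F}, {z \<in> Q. snd z \<in> F'}) = Q"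
        using choicesD(4)[OF Q] by fastforce
    qed
    show "(\<lambda>(A, B). A \<union> B) ` (choices F \<times> choices F') \<subseteq> choices (F \<union> F')"
      using un by auto
    show "(\<lambda>Q. ({z \<in> Q. snd z \<in> F}, {z \<in> Q. snd z \<in> F'})) ` choices (F \<union> F')
        \<subseteq> choices F \<times> choices F'"
      using choices_restrict[of _ "F \<union> F'"] by auto
  qed
  then show ?thesis by (metis bij_betw_same_card card_cartesian_product)
qed

lemma card_choices_UN:
  fixes E :: "'i \<Rightarrow> 'a set set"
  assumes "finite I"
    and "\<And>i j. i \<in> I \<Longrightarrow> j \<in> I \<Longrightarrow> i \<noteq> j \<Longrightarrow> \<Union>(E i) \<inter> \<Union>(E j) = {} \<and> E i \<inter> E j = {}"
  shows "card (choices (\<Union>i\<in>I. E i)) = (\<Prod>i\<in>I. card (choices (E i)))"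
  using assms
proof (induction I rule: finite_induct)
  case empty
  have "choices ({} :: 'a set set) = {{}}"
    by (auto simp: choices_def partial_choices_def)
  then show ?case by simp
next
  case (insert i I)
  have "\<Union>(E i) \<inter> \<Union>(\<Union>j\<in>I. E j) = {} \<and> E i \<inter> (\<Union>j\<in>I. E j) = {}"
    using insert.prems[of i] insert.hyps(2) by blast
  then have "card (choices (E i \<union> (\<Union>j\<in>I. E j)))
      = card (choices (E i)) * card (choices (\<Union>j\<in>I. E j))"
    by (intro card_choices_Un) auto
  then show ?case using insert by simp
qed

lemma component_cases:
  assumes "K \<in> components (V, F)"
  obtains v where "v \<in> V" "verts K = {u \<in> V. (v, u) \<in> (adj (V, F))\<^sup>*}"
    "edges K = {e \<in> F. e \<subseteq> verts K}"
  using assms by (auto simp: components_def induced_subgraph_def)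

lemma component_simple_connected:
  assumes G: "simple_graph (V, F)" and K: "K \<in> components (V, F)"
  shows "simple_graph K" "connected_graph K"
proof -
  obtain v where v: "v \<in> V" "verts K = {u \<in> V. (v, u) \<in> (adj (V, F))\<^sup>*}"
    "edges K = {e \<in> F. e \<subseteq> verts K}"
    by (rule component_cases[OF K])
  show "simple_graph K" using G by (auto simp: simple_graph_def v(2,3))
  \<comment> \<open>A walk from \<open>v\<close> never leaves the component of \<open>v\<close>, so
    all of its edges belong to the induced subgraph.\<close>
  have "(v, u) \<in> (adj K)\<^sup>*" if "(v, u) \<in> (adj (V, F))\<^sup>*" for u
    using that
  proof (induction rule: rtrancl_induct)
    case (step u w)
    have "{u, w} \<in> F" using step by simp
    moreover have "{u, w} \<subseteq> V" using G \<open>{u, w} \<in> F\<close> by (auto simp: simple_graph_def)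
    moreover have "(v, w) \<in> (adj (V, F))\<^sup>*" using step by (meson rtrancl_into_rtrancl)
    ultimately have "(u, w) \<in> adj K" using step(1) by (simp add: adj_def v(2,3))
    then show ?case using step.IH by (meson rtrancl_into_rtrancl)
  qed simp
  then have "\<forall>u\<in>verts K. (v, u) \<in> (adj K)\<^sup>*" using v(2) by simp
  moreover have "v \<in> verts K" using v(1,2) by simp
  ultimately show "connected_graph K"
    using connected_graph_root[of v "verts K" "edges K"] by simp
qed

lemma components_disjoint:
  assumes K: "K \<in> components (V, F)" and K': "K' \<in> components (V, F)" and ne: "K \<noteq> K'"
  shows "verts K \<inter> verts K' = {}"
proof (rule ccontr)
  let ?R = "(adj (V, F))\<^sup>*"
  assume "verts K \<inter> verts K' \<noteq> {}"
  then obtain u where u: "u \<in> verts K" "u \<in> verts K'" by blast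
  obtain v where v: "v \<in> V" "verts K = {u \<in> V. (v, u) \<in> ?R}" "edges K = {e \<in> F. e \<subseteq> verts K}"
    by (rule component_cases[OF K])
  obtain v' where v': "v' \<in> V" "verts K' = {u \<in> V. (v', u) \<in> ?R}"
    "edges K' = {e \<in> F. e \<subseteq> verts K'}"
    by (rule component_cases[OF K'])
  have vu: "(v, u) \<in> ?R" "(v', u) \<in> ?R" using u v(2) v'(2) by auto
  have "(v, v') \<in> ?R" "(v', v) \<in> ?R"
    using vu symD[OF sym_adj_rtrancl] by (meson rtrancl_trans)+
  then have "(v, w) \<in> ?R \<longleftrightarrow> (v', w) \<in> ?R" for w by (meson rtrancl_trans)
  then have "verts K = verts K'" by (simp add: v(2) v'(2))
  then show False using ne v(3) v'(3) by (simp add: prod_eq_iff)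
qed

lemma edges_eq_UN_components:
  assumes G: "simple_graph (V, F)"
  shows "F = (\<Union>K\<in>components (V, F). edges K)"
proof (intro equalityI subsetI)
  fix e assume e: "e \<in> F"
  then obtain u w where uw: "e = {u, w}" using G by (auto simp: simple_graph_def card_2_iff)
  let ?C = "{x \<in> V. (u, x) \<in> (adj (V, F))\<^sup>*}"
  have V: "u \<in> V" "w \<in> V" using e uw G by (auto simp: simple_graph_def)
  have "(u, w) \<in> adj (V, F)" using e uw by simp
  then have "e \<in> edges (induced_subgraph (V, F) ?C)"
    using V e uw by (auto simp: induced_subgraph_def)
  then show "e \<in> (\<Union>K\<in>components (V, F). edges K)"
    using V(1) unfolding components_def by auto
qed (auto simp: components_def induced_subgraph_def)

text \<open>The count is a product over the components, whose factors are those of the weight. A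
  component that is neither a tree nor unicyclic contributes the factor 0, which eliminates the edge
  sets that are not TU.\<close>

lemma card_choices_eq_weight:
  assumes G: "simple_graph (V, F)"
  shows "card (choices F) = (if is_TU (V, F) then TU_weight (V, F) else 0)"
proof -
  let ?C = "components (V, F)"
  let ?U = "{K \<in> ?C. is_unicyclic K}" and ?T = "{K \<in> ?C. is_tree K}"
  have finC: "finite ?C" using G by (simp add: components_def simple_graph_def)
  note comp = component_simple_connected[OF G]
  have "card (choices F) = card (choices (\<Union>K\<in>?C. edges K))"
    using edges_eq_UN_components[OF G] by simp
  also have "\<dots> = (\<Prod>K\<in>?C. card (choices (edges K)))"
  proof (rule card_choices_UN[OF finC])
    fix K K' assume K: "K \<in> ?C" "K' \<in> ?C" "K \<noteq> K'"
    \<comment> \<open>Edges are nonempty, so disjoint vertex sets force disjoint edge sets.\<close>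
    have sub: "e \<subseteq> verts K \<and> e \<noteq> {}" if "e \<in> edges K" "K \<in> ?C" for e K
      using comp(1)[OF that(2)] that(1) by (auto simp: simple_graph_def)
    then show "\<Union>(edges K) \<inter> \<Union>(edges K') = {} \<and> edges K \<inter> edges K' = {}"
      using components_disjoint[OF K] K(1,2) by blast
  qed
  finally have prod: "card (choices F) = (\<Prod>K\<in>?C. card (choices (edges K)))" .
  show ?thesis
  proof (cases "is_TU (V, F)")
    case True
    then have C: "?C = ?U \<union> ?T" by (auto simp: is_TU_def)
    have "?U \<inter> ?T = {}" by (auto simp: is_tree_def is_unicyclic_def)
    then have "(\<Prod>K\<in>?C. card (choices (edges K)))
        = (\<Prod>K\<in>?U. card (choices (edges K))) * (\<Prod>K\<in>?T. card (choices (edges K)))"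
      using finC by (subst C) (simp add: prod.union_disjoint)
    also have "(\<Prod>K\<in>?U. card (choices (edges K))) = (\<Prod>K\<in>?U. 2)"
      by (intro prod.cong refl card_choices_connected(2)) (use comp in blast)+
    also have "(\<Prod>K\<in>?T. card (choices (edges K))) = (\<Prod>K\<in>?T. card (verts K))"
      by (intro prod.cong refl card_choices_connected(1)) (use comp in blast)+
    finally show ?thesis using prod True by (simp add: TU_weight_def)
  next
    case False
    then obtain K where "K \<in> ?C" "\<not> is_tree K" "\<not> is_unicyclic K" by (auto simp: is_TU_def)
    then have "\<exists>K\<in>?C. card (choices (edges K)) = 0"
      using card_choices_connected(3) comp by blast
    then show ?thesis using prod prod_zero[OF finC] False by simp
  qed
qed

section \<open>Summation over edge sets and the final result\<close>

lemma card_partial_choices_eq_weight: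
  assumes G: "simple_graph G"
  shows "card {Q \<in> partial_choices (edges G). card Q = r} = (\<Sum>H\<in>TU_subgraphs G r. TU_weight H)"
proof -
  let ?E = "edges G" and ?V = "verts G"
  let ?S = "{F. F \<subseteq> ?E \<and> card F = r}"
  have GF: "simple_graph (?V, F)" if "F \<subseteq> ?E" for F
    using G that by (auto simp: simple_graph_def)
  have finS: "finite ?S" using finite_edges[OF G] by simp
  have "{Q \<in> partial_choices ?E. card Q = r} = (\<Union>F\<in>?S. choices F)"
  proof (intro equalityI subsetI)
    fix Q assume "Q \<in> {Q \<in> partial_choices ?E. card Q = r}"
    then have Q: "Q \<subseteq> incidences ?E" "inj_on fst Q" "inj_on snd Q" "card Q = r"
      by (auto simp: partial_choices_def)
    then have "Q \<in> choices (snd ` Q)" by (intro choicesI) (auto simp: incidences_def)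
    moreover have "snd ` Q \<in> ?S" using Q by (auto simp: incidences_def card_image)
    ultimately show "Q \<in> (\<Union>F\<in>?S. choices F)" by blast
  next
    fix Q assume "Q \<in> (\<Union>F\<in>?S. choices F)"
    then obtain F where F: "F \<subseteq> ?E" "card F = r" "Q \<in> choices F" by blast
    then have "Q \<in> partial_choices ?E"
      using incidences_mono[OF F(1)] by (auto simp: choices_def partial_choices_def)
    then show "Q \<in> {Q \<in> partial_choices ?E. card Q = r}" using card_choice(1)[OF F(3)] F(2) by simp
  qed
  also have "card \<dots> = (\<Sum>F\<in>?S. card (choices F))"
    using finS finite_choices[OF GF]
    by (intro card_UN_disjoint) (auto simp: choices_def)
  also have "\<dots> = (\<Sum>F\<in>?S. if is_TU (?V, F) then TU_weight (?V, F) else 0)"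
    using card_choices_eq_weight[OF GF] by (intro sum.cong) auto
  also have "\<dots> = (\<Sum>F | F \<in> ?S \<and> is_TU (?V, F). TU_weight (?V, F))"
    using finS by (rule sum.inter_filter[symmetric])
  also have "\<dots> = (\<Sum>H\<in>TU_subgraphs G r. TU_weight H)"
    by (rule sum.reindex_bij_witness[where i = snd and j = "\<lambda>F. (?V, F)"])
       (auto simp: TU_subgraphs_def)
  finally show ?thesis .
qed

theorem theorem2p6:
  fixes G :: "'a graph" and n :: nat
  assumes "simple_graph G" and "card (verts G) = n"
  shows "laplacian_matching_poly G = (\<Sum>r=0..n. monom ((- 1) ^ r * lmp_coeff G r) (n - r))
    \<and> (\<forall>r\<le>n. lmp_coeff G r = int (num_matchings (subdivision G) r)
        \<and> num_matchings (subdivision G) r = (\<Sum>H\<in>TU_subgraphs G r. TU_weight H))"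
  using laplacian_matching_poly_eq_sum[OF assms] lmp_coeff_eq_card[OF assms(1)] assms(2)
    card_partial_choices_eq_weight[OF assms(1)]
  by (auto simp: num_matchings_subdivision)

end
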